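(* Let $\mathcal A$ be a real symmetric tensor of order $m$ and dimension $n$, and let $\phi(x)=\frac1m\mathcal A x^m$. Suppose that the sequence $\{x_k\}$ generated by the Global Newton Algorithm (described in the context) applied to $\min_{x\in\mathbb B}\phi(x)$ converges to a point $\bar x$ at which the second order sufficient condition holds, i.e. $U_{\bar x}^TF'(\bar x)U_{\bar x}$ is positive definite. If the positive constant $\sigma$ in the algorithm satisfies $\sigma<\frac12$, then the convergence rate of $\{x_k\}$ is quadratic, i.e. $\|x_{k+1}-\bar x\|=O(\|x_k-\bar x\|^2)$. Moreover, after finitely many iterations, the steplength $\alpha_k=1$ is always accepted.
   Context: Let $m\ge 2$ and $n$ be positive integers, and let $\mathcal A=(a_{i_1\ldots i_m})$, $1\le i_1,\ldots,i_m\le n$, be a real symmetric tensor (entries invariant under permutation of indices). For $x\in\mathbb R^n$, $\mathcal A x^{m-1}\in\mathbb R^n$ has $i$-th entry $\sum_{i_2,\ldots,i_m}a_{ii_2\ldots i_m}x_{i_2}\cdots x_{i_m}$; $\mathcal A x^m=x^T(\mathcal A x^{m-1})\in\mathbb R$; and $\mathcal A x^{m-2}\in\mathbb R^{n\times n}$ has $(i,j)$ entry $\sum_{i_3,\ldots,i_m}a_{iji_3\ldots i_m}x_{i_3}\cdots x_{i_m}$. $\|\cdot\|$ is the Euclidean norm and $\mathbb B=\{x\in\mathbb R^n: x^Tx=1\}$. Let $\phi(x)=\frac1m\mathcal A x^m$, so $\nabla\phi(x)=\mathcal A x^{m-1}$. Let $F(x)=\mathcal A x^{m-1}-(\mathcal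 A x^m)\,x$, whose Jacobian is $F'(x)=(m-1)\mathcal A x^{m-2}-(\mathcal A x^m) I-m\,x(\mathcal A x^{m-1})^T$; for $x\in\mathbb B$, $F(x)=(I-xx^T)\nabla\phi(x)$. For $x\in\mathbb B$, $U_x\in\mathbb R^{n\times(n-1)}$ is a matrix whose columns form an orthogonal basis of $x^\perp=\{d\in\mathbb R^n: x^Td=0\}$. The second order sufficient condition is said to hold at $x\in\mathbb B$ if $U_x^TF'(x)U_x$ is positive definite. Curve descent direction: $d\in\mathbb R^n$ is a curve descent direction of a function $g$ at $x\in\mathbb B$ if $g\big(\frac{x+\alpha d}{\|x+\alpha d\|}\big)<g(x)$ for all sufficiently small $\alpha>0$. Newton direction at $x_k\in\mathbb B$: a vector $d_k$ solving $U_{x_k}^TF'(x_k)d_k+U_{x_k}^TF(x_k)=0$ and $x_k^Td_k=0$. Global Newton Algorithm. Fix constants $\sigma\in(0,\frac12)$, $\mu>0$, $\rho\in(0,1)$ and $x_0\in\mathbb B$. For $k=0,1,\ldots$, while $F(x_k)\ne0$: (1) let $d_k$ be the Newton direction at $x_k$; (2) if it does not exist or is not a curve descent direction of $\phi$ at $x_k$, let instead $d_k=-(I-x_kx_k^T)\nabla\phi(x_k)$, or let $d_k$ be the solution of $\big([F'(x_k)]^2+\mu\|F(x_k)\|I\big)d_k+F'(x_k)F(x_k)=0$; (3) with $x_k(\alpha)=\frac{x_k+\alpha d_k}{\|x_k+\alpha d_k\|}$, find by backtracking the largest $\alpha_k\in\{1,\rho,\rho^2,\ldots\}$ satisfying $\phi(x_k(\alpha_k))\le\phi(x_k)+\sigma\alpha_k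 F(x_k)^Td_k$; (4) let $x_{k+1}=x_k(\alpha_k)$. The statement concerns the case in which the algorithm generates an infinite sequence. *)

theory Defs
  imports "HOL-Analysis.Analysis" "HOL-Library.Landau_Symbols"
begin

text \<open>
  A tensor of order \<open>m\<close> and dimension \<open>CARD('n)\<close> is a function on index lists; only its values
  on lists of length \<open>m\<close> are relevant.
\<close>

definition symmetric_tensor :: "nat \<Rightarrow> ('n list \<Rightarrow> real) \<Rightarrow> bool" where
  "symmetric_tensor m A \<longleftrightarrow>
     (\<forall>is js. length is = m \<longrightarrow> mset is = mset js \<longrightarrow> A is = A js)"

definition monomial_at :: "real ^ 'n \<Rightarrow> 'n list \<Rightarrow> real" where
  "monomial_at x js = prod_list (map (\<lambda>j. x $ j) js)"

text \<open>The vector \<open>A x^(m-1)\<close>, the scalar \<open>A x^m\<close> and the matrix \<open>A x^(m-2)\<close>.\<close>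

definition tensor_vec :: "nat \<Rightarrow> ('n::finite list \<Rightarrow> real) \<Rightarrow> real ^ 'n \<Rightarrow> real ^ 'n" where
  "tensor_vec m A x = (\<chi> i. \<Sum>js | length js = m - 1. A (i # js) * monomial_at x js)"

definition tensor_form :: "nat \<Rightarrow> ('n::finite list \<Rightarrow> real) \<Rightarrow> real ^ 'n \<Rightarrow> real" where
  "tensor_form m A x = x \<bullet> tensor_vec m A x"

definition tensor_mat :: "nat \<Rightarrow> ('n::finite list \<Rightarrow> real) \<Rightarrow> real ^ 'n \<Rightarrow> real ^ 'n ^ 'n" where
  "tensor_mat m A x = (\<chi> i j. \<Sum>js | length js = m - 2. A (i # j # js) * monomial_at x js)"

definition outer :: "real ^ 'n \<Rightarrow> real ^ 'n \<Rightarrow> real ^ 'n ^ 'n" where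
  "outer x y = (\<chi> i j. x $ i * y $ j)"

definition phi :: "nat \<Rightarrow> ('n::finite list \<Rightarrow> real) \<Rightarrow> real ^ 'n \<Rightarrow> real" where
  "phi m A x = tensor_form m A x / real m"

text \<open>
  The gradient of \<^const>\<open>phi\<close> and the Jacobian of \<open>F\<close> are given by their explicit formulas;
  \<open>phi_gderiv\<close> and \<open>F_has_derivative\<close> below show that they are the derivatives.
\<close>

definition grad_phi :: "nat \<Rightarrow> ('n::finite list \<Rightarrow> real) \<Rightarrow> real ^ 'n \<Rightarrow> real ^ 'n" where
  "grad_phi m A x = tensor_vec m A x"

definition F :: "nat \<Rightarrow> ('n::finite list \<Rightarrow> real) \<Rightarrow> real ^ 'n \<Rightarrow> real ^ 'n" where
  "F m A x = tensor_vec m A x - tensor_form m A x *\<^sub>R x"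

definition F_jac :: "nat \<Rightarrow> ('n::finite list \<Rightarrow> real) \<Rightarrow> real ^ 'n \<Rightarrow> real ^ 'n ^ 'n" where
  "F_jac m A x = (real m - 1) *\<^sub>R tensor_mat m A x - tensor_form m A x *\<^sub>R mat 1
                 - real m *\<^sub>R outer x (tensor_vec m A x)"

text \<open>
  A matrix \<open>U\<close> with \<open>CARD('n) - 1\<close> columns is the list of its columns, since no type has
  \<open>CARD('n) - 1\<close> elements when \<open>CARD('n) = 1\<close>. The columns need not have unit length.
\<close>

definition tangent_basis :: "real ^ 'n \<Rightarrow> (real ^ 'n) list \<Rightarrow> bool" where
  "tangent_basis x U \<longleftrightarrow>
     length U = CARD('n) - 1 \<and> distinct U \<and> pairwise orthogonal (set U) \<and>
     independent (set U) \<and> span (set U) = {d. x \<bullet> d = 0}"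

text \<open>The \<open>(i, j)\<close> entry of \<open>U^T M U\<close>.\<close>

definition compress :: "(real ^ 'n) list \<Rightarrow> real ^ 'n ^ 'n \<Rightarrow> nat \<Rightarrow> nat \<Rightarrow> real" where
  "compress U M i j = (U ! i) \<bullet> (M *v (U ! j))"

definition pos_def :: "nat \<Rightarrow> (nat \<Rightarrow> nat \<Rightarrow> real) \<Rightarrow> bool" where
  "pos_def k B \<longleftrightarrow>
     (\<forall>y. (\<exists>i<k. y i \<noteq> 0) \<longrightarrow> 0 < (\<Sum>i<k. \<Sum>j<k. y i * B i j * y j))"

definition second_order_sufficient ::
  "nat \<Rightarrow> ('n::finite list \<Rightarrow> real) \<Rightarrow> (real ^ 'n) list \<Rightarrow> real ^ 'n \<Rightarrow> bool" where
  "second_order_sufficient m A U x \<longleftrightarrow> pos_def (length U) (compress U (F_jac m A x))"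

definition curve :: "real ^ 'n \<Rightarrow> real ^ 'n \<Rightarrow> real \<Rightarrow> real ^ 'n" where
  "curve x d \<alpha> = (x + \<alpha> *\<^sub>R d) /\<^sub>R norm (x + \<alpha> *\<^sub>R d)"

definition curve_descent :: "(real ^ 'n \<Rightarrow> real) \<Rightarrow> real ^ 'n \<Rightarrow> real ^ 'n \<Rightarrow> bool" where
  "curve_descent g x d \<longleftrightarrow> (\<forall>\<^sub>F \<alpha> in at_right 0. g (curve x d \<alpha>) < g x)"

definition newton_direction ::
  "nat \<Rightarrow> ('n::finite list \<Rightarrow> real) \<Rightarrow> (real ^ 'n) list \<Rightarrow> real ^ 'n \<Rightarrow> real ^ 'n \<Rightarrow> bool" where
  "newton_direction m A U x d \<longleftrightarrow>
     (\<forall>j<length U. (U ! j) \<bullet> (F_jac m A x *v d) + (U ! j) \<bullet> F m A x = 0) \<and> x \<bullet> d = 0"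

definition fallback_direction ::
  "nat \<Rightarrow> ('n::finite list \<Rightarrow> real) \<Rightarrow> real \<Rightarrow> real ^ 'n \<Rightarrow> real ^ 'n \<Rightarrow> bool" where
  "fallback_direction m A \<mu> x d \<longleftrightarrow>
     d = - ((mat 1 - outer x x) *v grad_phi m A x) \<or>
     (F_jac m A x ** F_jac m A x + (\<mu> * norm (F m A x)) *\<^sub>R mat 1) *v d
       + F_jac m A x *v F m A x = 0"

text \<open>
  If the Newton system has several solutions, any of them may be the Newton direction that is tried
  in step 1; the fallback is open whenever the one tried is not a curve descent direction.
\<close>

definition step_direction ::
  "nat \<Rightarrow> ('n::finite list \<Rightarrow> real) \<Rightarrow> (real ^ 'n) list \<Rightarrow> real \<Rightarrow> real ^ 'n \<Rightarrow> real ^ 'n \<Rightarrow> bool" where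
  "step_direction m A U \<mu> x d \<longleftrightarrow>
     newton_direction m A U x d \<and> curve_descent (phi m A) x d \<or>
     ((\<nexists>e. newton_direction m A U x e) \<or>
      (\<exists>e. newton_direction m A U x e \<and> \<not> curve_descent (phi m A) x e)) \<and>
     fallback_direction m A \<mu> x d"

text \<open>
  The first conjunct excludes trial steps at which \<open>x(\<alpha>)\<close> is undefined; this can only occur for
  fallback directions, which need not be tangent to the sphere.
\<close>

definition armijo ::
  "nat \<Rightarrow> ('n::finite list \<Rightarrow> real) \<Rightarrow> real \<Rightarrow> real ^ 'n \<Rightarrow> real ^ 'n \<Rightarrow> real \<Rightarrow> bool" where
  "armijo m A \<sigma> x d \<alpha> \<longleftrightarrow>
     x + \<alpha> *\<^sub>R d \<noteq> 0 \<and>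
     phi m A (curve x d \<alpha>) \<le> phi m A x + \<sigma> * \<alpha> * (F m A x \<bullet> d)"

definition backtracking_step ::
  "nat \<Rightarrow> ('n::finite list \<Rightarrow> real) \<Rightarrow> real \<Rightarrow> real \<Rightarrow> real ^ 'n \<Rightarrow> real ^ 'n \<Rightarrow> real \<Rightarrow> bool" where
  "backtracking_step m A \<sigma> \<rho> x d \<alpha> \<longleftrightarrow>
     \<alpha> \<in> range (\<lambda>i::nat. \<rho> ^ i) \<and> armijo m A \<sigma> x d \<alpha> \<and>
     (\<forall>\<beta> \<in> range (\<lambda>i::nat. \<rho> ^ i). armijo m A \<sigma> x d \<beta> \<longrightarrow> \<beta> \<le> \<alpha>)"

text \<open>
  An infinite run of the algorithm: iterates \<open>x\<close>, directions \<open>d\<close>, steplengths \<open>\<alpha>\<close>; \<open>U y\<close> is the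
  matrix used at the point \<open>y\<close> of the sphere.
\<close>

definition global_newton_run ::
  "nat \<Rightarrow> ('n::finite list \<Rightarrow> real) \<Rightarrow> (real ^ 'n \<Rightarrow> (real ^ 'n) list) \<Rightarrow> real \<Rightarrow> real \<Rightarrow> real
   \<Rightarrow> (nat \<Rightarrow> real ^ 'n) \<Rightarrow> (nat \<Rightarrow> real ^ 'n) \<Rightarrow> (nat \<Rightarrow> real) \<Rightarrow> bool" where
  "global_newton_run m A U \<sigma> \<mu> \<rho> x d \<alpha> \<longleftrightarrow>
     x 0 \<in> sphere 0 1 \<and>
     (\<forall>k. F m A (x k) \<noteq> 0 \<and>
          step_direction m A (U (x k)) \<mu> (x k) (d k) \<and>
          backtracking_step m A \<sigma> \<rho> (x k) (d k) (\<alpha> k) \<and>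
          x (Suc k) = curve (x k) (d k) (\<alpha> k))"

text \<open>Contraction of all but the leading indices \<open>is\<close>.\<close>

definition contract :: "('n::finite list \<Rightarrow> real) \<Rightarrow> nat \<Rightarrow> 'n list \<Rightarrow> real ^ 'n \<Rightarrow> real" where
  "contract A r is x = (\<Sum>js | length js = r. A (is @ js) * monomial_at x js)"

lemma contract_0: "contract A 0 is x = A is"
  by (simp add: contract_def monomial_at_def)

lemma contract_Suc: "contract A (Suc r) is x = (\<Sum>j\<in>UNIV. x $ j * contract A r (is @ [j]) x)"
proof -
  have eq: "{js :: 'a list. length js = Suc r} = (\<lambda>(j, js). j # js) ` (UNIV \<times> {js. length js = r})"
    by (auto simp: length_Suc_conv)
  have inj: "inj_on (\<lambda>(j, js). j # js) (UNIV \<times> {js :: 'a list. length js = r})"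
    by (auto simp: inj_on_def)
  show ?thesis
    unfolding contract_def eq sum.reindex[OF inj]
    by (simp add: sum.cartesian_product sum_distrib_left monomial_at_def
        case_prod_unfold mult_ac)
qed

lemma contract_swap:
  assumes "symmetric_tensor m A" "m = length is + 2 + r"
  shows "contract A r (is @ [j, k]) x = contract A r (is @ [k, j]) x"
proof -
  have "A ((is @ [j, k]) @ js) = A ((is @ [k, j]) @ js)" if "length js = r" for js
    using assms that unfolding symmetric_tensor_def
    by (intro assms(1)[unfolded symmetric_tensor_def, rule_format]) auto
  then show ?thesis
    unfolding contract_def by (intro sum.cong) auto
qed

lemma contract_has_derivative:
  assumes "symmetric_tensor m A" "m = length is + r"
  shows "((\<lambda>y. contract A r is y) has_derivative
           (\<lambda>h. real r * (\<Sum>j\<in>UNIV. h $ j * contract A (r - 1) (is @ [j]) x))) (at x)"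
  using assms(2)
proof (induction r arbitrary: "is")
  case 0
  then show ?case by (simp add: contract_0)
next
  case (Suc r)
  have IH: "((\<lambda>y. contract A r (is @ [j]) y) has_derivative
      (\<lambda>h. real r * (\<Sum>k\<in>UNIV. h $ k * contract A (r - 1) (is @ [j, k]) x))) (at x)" for j
    using Suc.IH[of "is @ [j]"] Suc.prems by simp
  have nth: "((\<lambda>y. y $ j) has_derivative (\<lambda>h. h $ j)) (at x)" for j
    by (rule bounded_linear.has_derivative[OF bounded_linear_vec_nth has_derivative_ident])
  have D: "((\<lambda>y. \<Sum>j\<in>UNIV. y $ j * contract A r (is @ [j]) y) has_derivative
     (\<lambda>h. \<Sum>j\<in>UNIV. x $ j * (real r * (\<Sum>k\<in>UNIV. h $ k * contract A (r - 1) (is @ [j, k]) x))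
        + h $ j * contract A r (is @ [j]) x)) (at x)"
    by (intro has_derivative_sum has_derivative_mult nth IH)
  have "real r * (\<Sum>j\<in>UNIV. x $ j * (\<Sum>k\<in>UNIV. h $ k * contract A (r - 1) (is @ [j, k]) x)) =
        real r * (\<Sum>k\<in>UNIV. h $ k * contract A r (is @ [k]) x)" for h
  proof (cases r)
    case r: (Suc q)
    have "(\<Sum>j\<in>UNIV. x $ j * (\<Sum>k\<in>UNIV. h $ k * contract A q (is @ [j, k]) x)) =
          (\<Sum>k\<in>UNIV. \<Sum>j\<in>UNIV. x $ j * (h $ k * contract A q (is @ [j, k]) x))"
      by (subst sum.swap) (simp add: sum_distrib_left)
    also have "\<dots> = (\<Sum>k\<in>UNIV. h $ k * contract A r (is @ [k]) x)"
      unfolding r contract_Suc sum_distrib_left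
      by (intro sum.cong refl)
         (use contract_swap[OF assms(1), of "is" q] Suc.prems r in \<open>simp add: mult_ac\<close>)
    finally show ?thesis by (simp add: r)
  qed simp
  then have "(\<Sum>j\<in>UNIV. x $ j * (real r * (\<Sum>k\<in>UNIV. h $ k * contract A (r - 1) (is @ [j, k]) x))
        + h $ j * contract A r (is @ [j]) x) =
      real (Suc r) * (\<Sum>j\<in>UNIV. h $ j * contract A (Suc r - 1) (is @ [j]) x)" for h
    by (simp add: sum.distrib sum_distrib_left algebra_simps)
  with D show ?case
    by (simp add: contract_Suc)
qed

lemma tensor_form_contract:
  assumes "m \<ge> 1"
  shows "tensor_form m A x = contract A m [] x"
proof -
  obtain q where "m = Suc q" using assms by (cases m) auto
  then show ?thesis
    by (simp add: tensor_form_def inner_vec_def tensor_vec_def contract_Suc) (simp add: contract_def)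
qed

lemma tensor_form_has_derivative:
  fixes A :: "'n::finite list \<Rightarrow> real"
  assumes "symmetric_tensor m A" "m \<ge> 1"
  shows "(tensor_form m A has_derivative (\<lambda>h. real m * (h \<bullet> tensor_vec m A x))) (at x)"
proof -
  have "tensor_form m A = (\<lambda>y. contract A m [] y)"
    by (rule ext) (rule tensor_form_contract[OF assms(2)])
  moreover have "(\<Sum>j\<in>UNIV. h $ j * contract A (m - 1) ([] @ [j]) x) = h \<bullet> tensor_vec m A x" for h
    by (simp add: inner_vec_def tensor_vec_def contract_def)
  ultimately show ?thesis
    using contract_has_derivative[OF assms(1), of "[]" m x] by simp
qed

lemma tensor_vec_has_derivative:
  fixes A :: "'n::finite list \<Rightarrow> real"
  assumes "symmetric_tensor m A" "m \<ge> 2"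
  shows "(tensor_vec m A has_derivative (\<lambda>h. (real m - 1) *\<^sub>R (tensor_mat m A x *v h))) (at x)"
proof -
  have "((\<lambda>y. tensor_vec m A y $ i) has_derivative
      (\<lambda>h. ((real m - 1) *\<^sub>R (tensor_mat m A x *v h)) $ i)) (at x)" for i
    using contract_has_derivative[OF assms(1), of "[i]" "m - 1" x] assms(2)
    by (simp add: tensor_vec_def tensor_mat_def contract_def matrix_vector_mult_def
        of_nat_diff mult_ac numeral_2_eq_2)
  then show ?thesis
    by (subst has_derivative_componentwise_within)
       (auto simp: Basis_vec_def inner_axis)
qed

lemma phi_gderiv:
  assumes "symmetric_tensor m A" "m \<ge> 2"
  shows "GDERIV (phi m A) x :> grad_phi m A x"
proof -
  have "((\<lambda>y. tensor_form m A y * (1 / real m)) has_derivative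
      (\<lambda>h. real m * (h \<bullet> tensor_vec m A x) * (1 / real m))) (at x)"
    using assms by (intro has_derivative_mult_left tensor_form_has_derivative) auto
  then show ?thesis
    using assms(2) by (simp add: gderiv_def phi_def[abs_def] grad_phi_def)
qed

lemma F_has_derivative:
  assumes "symmetric_tensor m A" "m \<ge> 2"
  shows "(F m A has_derivative (\<lambda>h. F_jac m A x *v h)) (at x)"
proof -
  have "outer x v *v h = (h \<bullet> v) *\<^sub>R x" for v h
    by (simp add: vec_eq_iff outer_def matrix_vector_mult_def inner_vec_def sum_distrib_left mult_ac)
  then have "F_jac m A x *v h = (real m - 1) *\<^sub>R (tensor_mat m A x *v h) -
      (tensor_form m A x *\<^sub>R h + (real m * (h \<bullet> tensor_vec m A x)) *\<^sub>R x)" for h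
    by (simp add: F_jac_def matrix_vector_mult_diff_rdistrib scaleR_matrix_vector_assoc[symmetric])
  moreover have "((\<lambda>y. tensor_vec m A y - tensor_form m A y *\<^sub>R y) has_derivative
      (\<lambda>h. (real m - 1) *\<^sub>R (tensor_mat m A x *v h) -
           (tensor_form m A x *\<^sub>R h + (real m * (h \<bullet> tensor_vec m A x)) *\<^sub>R x))) (at x)"
    using assms
    by (intro has_derivative_diff has_derivative_scaleR has_derivative_ident
        tensor_vec_has_derivative tensor_form_has_derivative) auto
  ultimately show ?thesis
    by (simp add: F_def[abs_def])
qed

end

theory Submission imports Defs begin

text \<open>
  On the sphere, \<open>phi\<close> along the curve through a tangent vector \<open>v\<close> has the expansion
  \<open>phi x + F x \<bullet> v + v \<bullet> F' x v / 2 + O(|v|^3)\<close>, uniformly in \<open>x\<close>. Near \<open>xbar\<close> the form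
  \<open>v \<bullet> F' x v\<close> is uniformly coercive on tangent vectors, so the Newton direction exists, and as
  \<open>d \<bullet> F' x d = - F x \<bullet> d\<close> it is a descent direction and satisfies the Armijo condition for every
  steplength \<open>a \<le> 1\<close> with \<open>a |d| \<le> \<eta>\<close>, where \<open>\<eta>\<close> does not depend on \<open>x\<close>. Backtracking therefore
  gives \<open>\<alpha> = 1\<close> or \<open>\<alpha> |d| > \<rho> \<eta>\<close>; the latter is excluded eventually, because convergence of the iterates
  forces \<open>\<alpha>\<^sub>k |d\<^sub>k| \<longlonglongrightarrow> 0\<close>. So full steps are taken eventually, hence \<open>d\<^sub>k \<longlonglongrightarrow> 0\<close> and
  \<open>F xbar = 0\<close>, and the usual error estimate of Newton's method gives the quadratic rate.
\<close>

subsection \<open>Polynomial maps on the unit ball\<close>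

text \<open>Cauchy-Schwarz in each row. The norm of a matrix is here the Euclidean norm of its
  entries, which dominates the operator norm.\<close>

lemma norm_matrix_vector_mult_le:
  fixes M :: "real ^ 'n ^ 'm"
  shows "norm (M *v v) \<le> norm M * norm v"
proof -
  have "norm (M *v v) = L2_set (\<lambda>i. \<bar>M $ i \<bullet> v\<bar>) UNIV"
    by (simp add: norm_vec_def matrix_vector_mult_def inner_vec_def)
  also have "\<dots> \<le> L2_set (\<lambda>i. norm (M $ i) * norm v) UNIV"
    by (intro L2_set_mono Cauchy_Schwarz_ineq2) auto
  also have "\<dots> = norm M * norm v"
    by (simp add: norm_vec_def L2_set_left_distrib)
  finally show ?thesis .
qed

lemma polynomial_function_continuous_on:
  fixes f :: "'a::euclidean_space \<Rightarrow> 'b::euclidean_space"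
  shows "polynomial_function f \<Longrightarrow> continuous_on S f"
  using differentiable_at_polynomial_function differentiable_imp_continuous_within
  by (metis continuous_at_imp_continuous_on)

lemma polynomial_function_bounded:
  fixes f :: "'a::euclidean_space \<Rightarrow> 'b::euclidean_space"
  assumes "polynomial_function f"
  obtains B where "B > 0" "\<And>x. x \<in> cball 0 r \<Longrightarrow> norm (f x) \<le> B"
proof -
  have "compact (f ` cball 0 r)"
    by (intro compact_continuous_image polynomial_function_continuous_on assms compact_cball)
  then have "bounded (f ` cball 0 r)"
    by (rule compact_imp_bounded)
  then show ?thesis
    using that unfolding bounded_pos by blast
qed

text \<open>Induction on the construction of the polynomial. For a product, the Lipschitz bounds of
  the factors are combined with their boundedness on the ball.\<close>

lemma real_polynomial_function_lipschitz:
  fixes f :: "'a::euclidean_space \<Rightarrow> real"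
  assumes "real_polynomial_function f"
  shows "\<exists>L. L-lipschitz_on (cball 0 r) f"
  using assms
proof induction
  case (linear f)
  then obtain K where "K \<ge> 0" "\<And>x. norm (f x) \<le> norm x * K"
    using bounded_linear.nonneg_bounded by blast
  with linear have "K-lipschitz_on (cball 0 r) f"
    by (intro lipschitz_onI) (simp_all add: dist_norm linear_diff bounded_linear.linear mult.commute flip: linear_diff)
  then show ?case by blast
next
  case (const c)
  then show ?case
    using lipschitz_on_constant by blast
next
  case (add f g)
  then show ?case
    using lipschitz_on_add by blast
next
  case (mult f g)
  then obtain L K where LK: "L-lipschitz_on (cball 0 r) f" "K-lipschitz_on (cball 0 r) g"
    by blast
  obtain B where B: "B > 0" "\<And>x. x \<in> cball 0 r \<Longrightarrow> norm (f x) \<le> B"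
    using polynomial_function_bounded mult.hyps real_polynomial_function_eq by metis
  obtain C where C: "C > 0" "\<And>x. x \<in> cball 0 r \<Longrightarrow> norm (g x) \<le> C"
    using polynomial_function_bounded mult.hyps real_polynomial_function_eq by metis
  have "(B * K + L * C)-lipschitz_on (cball 0 r) (\<lambda>x. f x * g x)"
  proof (rule lipschitz_onI)
    fix x y :: 'a assume xy: "x \<in> cball 0 r" "y \<in> cball 0 r"
    have "dist (f x * g x) (f y * g y) = \<bar>f x * (g x - g y) + (f x - f y) * g y\<bar>"
      by (simp add: dist_real_def algebra_simps)
    also have "\<dots> \<le> \<bar>f x\<bar> * \<bar>g x - g y\<bar> + \<bar>f x - f y\<bar> * \<bar>g y\<bar>"
      by (metis abs_mult abs_triangle_ineq)
    also have "\<dots> \<le> B * (K * dist x y) + (L * dist x y) * C"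
      using lipschitz_onD[OF LK(1) xy] lipschitz_onD[OF LK(2) xy] B(2)[OF xy(1)] C(2)[OF xy(2)] B(1)
      by (intro add_mono mult_mono) (auto simp: dist_real_def intro: order_trans[rotated])
    finally show "dist (f x * g x) (f y * g y) \<le> (B * K + L * C) * dist x y"
      by (simp add: algebra_simps)
  qed (use LK B(1) C(1) lipschitz_on_nonneg in \<open>auto intro!: add_nonneg_nonneg mult_nonneg_nonneg\<close>)
  then show ?case by blast
qed

lemma polynomial_function_lipschitz:
  fixes f :: "'a::euclidean_space \<Rightarrow> 'b::euclidean_space"
  assumes "polynomial_function f"
  obtains L where "L > 0"
    "\<And>x y. \<lbrakk>x \<in> cball 0 r; y \<in> cball 0 r\<rbrakk> \<Longrightarrow> norm (f x - f y) \<le> L * norm (x - y)"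
proof -
  have "\<exists>L. L-lipschitz_on (cball 0 r) (\<lambda>x. f x \<bullet> b)" if "b \<in> Basis" for b
    using assms that polynomial_function_iff_Basis_inner real_polynomial_function_lipschitz by blast
  then obtain L where L: "\<And>b. b \<in> Basis \<Longrightarrow> (L b)-lipschitz_on (cball 0 r) (\<lambda>x. f x \<bullet> b)"
    by metis
  have nn: "0 \<le> sum L Basis"
    using L lipschitz_on_nonneg by (blast intro: sum_nonneg)
  \<comment> \<open>The summand 1 makes the constant strictly positive even if every
    \<open>L b\<close> is 0.\<close>
  have "norm (f x - f y) \<le> (sum L Basis + 1) * norm (x - y)"
    if xy: "x \<in> cball 0 r" "y \<in> cball 0 r" for x y
  proof -
    have "norm (f x - f y) \<le> (\<Sum>b\<in>Basis. \<bar>(f x - f y) \<bullet> b\<bar>)"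
      by (rule norm_le_l1)
    also have "\<dots> \<le> (\<Sum>b\<in>Basis. L b * norm (x - y))"
      using lipschitz_onD[OF L xy] by (intro sum_mono) (simp add: dist_norm inner_diff_left)
    also have "\<dots> \<le> (sum L Basis + 1) * norm (x - y)"
      by (simp add: sum_distrib_right algebra_simps)
    finally show ?thesis .
  qed
  with nn show ?thesis
    by (intro that[of "sum L Basis + 1"]) auto
qed

text \<open>The Jacobian is Lipschitz on the ball, and by convexity the segment from
  \<open>x\<close> to \<open>y\<close> stays there. So the Jacobian varies by at most
  \<open>L * norm (y - x)\<close> along the segment, and the mean value inequality yields the
  square. One \<open>L\<close> serves all base points.\<close>

lemma taylor_remainder_polynomial_jacobian:
  fixes g :: "real ^ 'n \<Rightarrow> real ^ 'm" and J :: "real ^ 'n \<Rightarrow> real ^ 'n ^ 'm"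
  assumes g: "\<And>x. (g has_derivative (\<lambda>h. J x *v h)) (at x)" and J: "polynomial_function J"
  obtains L where "L > 0"
    "\<And>x y. \<lbrakk>x \<in> cball 0 1; y \<in> cball 0 1\<rbrakk> \<Longrightarrow>
       norm (g y - g x - J x *v (y - x)) \<le> L * (norm (y - x))\<^sup>2"
proof -
  obtain L where L: "L > 0" "\<And>x y. \<lbrakk>x \<in> cball 0 1; y \<in> cball 0 1\<rbrakk> \<Longrightarrow>
      norm (J x - J y) \<le> L * norm (x - y)"
    using polynomial_function_lipschitz[OF J] by metis
  have "norm (g y - g x - J x *v (y - x)) \<le> L * (norm (y - x))\<^sup>2"
    if xy: "x \<in> cball 0 1" "y \<in> cball 0 1" for x y
  proof -
    have "onorm ((*v) (J z) - (*v) (J x)) \<le> L * norm (y - x)" if z: "z \<in> closed_segment x y" for z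
    proof (rule onorm_le)
      fix v :: "real ^ 'n"
      have "z \<in> cball 0 1"
        using z xy closed_segment_subset[OF xy convex_cball] by blast
      then have "norm (J z - J x) \<le> L * norm (z - x)"
        using L xy by blast
      also have "\<dots> \<le> L * norm (y - x)"
        using L(1) segment_bound1[OF z] by (simp add: norm_minus_commute)
      finally have "norm (J z - J x) * norm v \<le> L * norm (y - x) * norm v"
        by (simp add: mult_right_mono)
      moreover have "((*v) (J z) - (*v) (J x)) v = (J z - J x) *v v"
        by (simp add: matrix_vector_mult_diff_rdistrib)
      ultimately show "norm (((*v) (J z) - (*v) (J x)) v) \<le> L * norm (y - x) * norm v"
        using norm_matrix_vector_mult_le[of "J z - J x" v] by simp
    qed
    moreover have "x + t *\<^sub>R (y - x) \<in> closed_segment x y" if "t \<in> {0..1}" for t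
      using that by (auto simp: closed_segment_def algebra_simps intro!: exI[of _ t])
    ultimately have "norm (g y - g x - J x *v (y - x)) \<le> norm (y - x) * (L * norm (y - x))"
      by (intro differentiable_bound_linearization[where S = "closed_segment x y"])
         (auto intro!: has_derivative_at_withinI[OF g])
    then show ?thesis
      by (simp add: power2_eq_square mult_ac)
  qed
  then show ?thesis
    using that L(1) by blast
qed

section \<open>The tensor maps as polynomial functions\<close>

lemma polynomial_function_vec:
  fixes f :: "'a::euclidean_space \<Rightarrow> 'b::euclidean_space ^ 'n"
  assumes "\<And>i. polynomial_function (\<lambda>x. f x $ i)"
  shows "polynomial_function f"
  using assms by (auto simp: polynomial_function_iff_Basis_inner Basis_vec_def inner_axis)

lemma polynomial_function_vec_nth: "polynomial_function (\<lambda>x :: real ^ 'n. x $ i)"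
  by (intro polynomial_function_bounded_linear bounded_linear_vec_nth)

lemma polynomial_function_vec_nth_compose:
  fixes f :: "'a::euclidean_space \<Rightarrow> real ^ 'n"
  shows "polynomial_function f \<Longrightarrow> polynomial_function (\<lambda>x. f x $ i)"
  using polynomial_function_compose[OF _ polynomial_function_vec_nth[of i], of f]
  by (simp add: o_def)

lemma polynomial_function_mult_real:
  "polynomial_function f \<Longrightarrow> polynomial_function g \<Longrightarrow> polynomial_function (\<lambda>x. f x * g x :: real)"
  by (simp add: real_polynomial_function_eq[symmetric] real_polynomial_function.intros(4))

lemma polynomial_function_monomial_at: "polynomial_function (\<lambda>x :: real ^ 'n. monomial_at x js)"
  by (induction js)
     (auto simp: monomial_at_def intro: polynomial_function_mult_real polynomial_function_vec_nth)

lemma polynomial_function_tensor_vec: "polynomial_function (tensor_vec m A)"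
  unfolding tensor_vec_def
  by (rule polynomial_function_vec)
     (auto intro!: polynomial_function_sum polynomial_function_mult_real polynomial_function_monomial_at
       finite_list_length)

lemma polynomial_function_tensor_mat: "polynomial_function (tensor_mat m A)"
  unfolding tensor_mat_def
  by (intro polynomial_function_vec)
     (auto intro!: polynomial_function_sum polynomial_function_mult_real polynomial_function_monomial_at
       finite_list_length)

lemma polynomial_function_tensor_form: "polynomial_function (tensor_form m A)"
  unfolding tensor_form_def inner_vec_def inner_real_def
  by (intro polynomial_function_sum polynomial_function_mult_real finite polynomial_function_vec_nth
      polynomial_function_vec_nth_compose polynomial_function_tensor_vec)

lemma polynomial_function_F: "polynomial_function (F m A)"
  unfolding F_def
  by (intro polynomial_function_diff polynomial_function_mult polynomial_function_id
      polynomial_function_tensor_vec polynomial_function_tensor_form)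

lemma polynomial_function_outer:
  fixes f g :: "'a::euclidean_space \<Rightarrow> real ^ 'n"
  shows "polynomial_function f \<Longrightarrow> polynomial_function g \<Longrightarrow> polynomial_function (\<lambda>x. outer (f x) (g x))"
  unfolding outer_def
  by (intro polynomial_function_vec)
     (simp add: polynomial_function_mult_real polynomial_function_vec_nth_compose)

lemma polynomial_function_F_jac: "polynomial_function (F_jac m A)"
  unfolding F_jac_def
  by (intro polynomial_function_diff polynomial_function_cmul polynomial_function_mult
      polynomial_function_tensor_mat polynomial_function_tensor_form polynomial_function_const
      polynomial_function_outer polynomial_function_id polynomial_function_tensor_vec)

subsection \<open>Expansions of \<open>phi\<close> on the sphere\<close>

text \<open>Third order is reached without third derivatives: the quadratic remainder bound for the
  gradient \<open>tensor_vec\<close> is fed into the mean value theorem along the segment.\<close>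

lemma phi_taylor_remainder:
  fixes A :: "'n::finite list \<Rightarrow> real"
  assumes "symmetric_tensor m A" "m \<ge> 2"
  obtains L where "L > 0"
    "\<And>x y. \<lbrakk>x \<in> cball 0 1; y \<in> cball 0 1\<rbrakk> \<Longrightarrow>
       \<bar>phi m A y - phi m A x - tensor_vec m A x \<bullet> (y - x)
         - (real m - 1) / 2 * ((y - x) \<bullet> (tensor_mat m A x *v (y - x)))\<bar> \<le> L * norm (y - x) ^ 3"
proof -
  let ?v = "tensor_vec m A" and ?J = "\<lambda>x. (real m - 1) *\<^sub>R tensor_mat m A x"
  obtain L where L: "L > 0" "\<And>x y. \<lbrakk>x \<in> cball 0 1; y \<in> cball 0 1\<rbrakk> \<Longrightarrow>
      norm (?v y - ?v x - ?J x *v (y - x)) \<le> L * (norm (y - x))\<^sup>2"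
  proof (rule taylor_remainder_polynomial_jacobian[of ?v ?J])
    show "(?v has_derivative (*v) (?J x)) (at x)" for x
      using tensor_vec_has_derivative[OF assms] by (simp add: scaleR_matrix_vector_assoc)
    show "polynomial_function ?J"
      by (intro polynomial_function_cmul polynomial_function_tensor_mat)
  qed blast
  have "\<bar>phi m A y - phi m A x - ?v x \<bullet> (y - x) - (real m - 1) / 2 * ((y - x) \<bullet> (tensor_mat m A x *v (y - x)))\<bar>
          \<le> L * norm (y - x) ^ 3"
    if xy: "x \<in> cball 0 1" "y \<in> cball 0 1" for x y
  proof -
    define h where "h = y - x"
    \<comment> \<open>Since \<open>r 0 = phi m A x\<close>, the difference \<open>r 1 - r 0\<close>
      is the remainder to be bounded. Its derivative \<open>r'\<close> pairs \<open>h\<close> with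
      the first-order remainder of the gradient.\<close>
    define r where "r t = phi m A (x + t *\<^sub>R h) - t * (?v x \<bullet> h) - t\<^sup>2 / 2 * (h \<bullet> (?J x *v h))" for t
    define r' where "r' t = h \<bullet> (?v (x + t *\<^sub>R h) - ?v x - t *\<^sub>R (?J x *v h))" for t
    have "(phi m A has_derivative (\<lambda>k. k \<bullet> ?v z)) (at z)" for z
      using phi_gderiv[OF assms] by (simp add: gderiv_def grad_phi_def)
    then have "((\<lambda>t. phi m A (x + t *\<^sub>R h)) has_derivative (\<lambda>s. (s *\<^sub>R h) \<bullet> ?v (x + t *\<^sub>R h))) (at t)" for t
      by (rule has_derivative_compose[rotated]) (auto intro!: derivative_eq_intros)
    then have phi': "((\<lambda>t. phi m A (x + t *\<^sub>R h)) has_real_derivative h \<bullet> ?v (x + t *\<^sub>R h)) (at t)" for t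
      unfolding has_field_derivative_def by (simp add: mult_commute_abs)
    have "(r has_real_derivative r' t) (at t)" for t
      unfolding r_def[abs_def] r'_def
      by (auto intro!: derivative_eq_intros phi' simp: inner_diff_right inner_commute)
    then obtain t where t: "0 < t" "t < 1" "r 1 - r 0 = (1 - 0) * r' t"
      using MVT2[of 0 1 r r'] by auto
    have xh: "x + t *\<^sub>R h \<in> cball 0 1"
    proof -
      have "x + t *\<^sub>R h \<in> closed_segment x y"
        using t by (auto simp: closed_segment_def h_def algebra_simps intro!: exI[of _ t])
      then show ?thesis
        using closed_segment_subset[OF xy convex_cball] by blast
    qed
    have "\<bar>r' t\<bar> \<le> norm h * norm (?v (x + t *\<^sub>R h) - ?v x - ?J x *v (t *\<^sub>R h))"
      unfolding r'_def matrix_vector_mult_scaleR by (rule Cauchy_Schwarz_ineq2)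
    also have "\<dots> \<le> norm h * (L * (norm (t *\<^sub>R h))\<^sup>2)"
      using L(2)[OF xy(1) xh] by (intro mult_left_mono) auto
    also have "\<dots> \<le> norm h * (L * (norm h)\<^sup>2)"
      using t L(1) by (intro mult_left_mono power_mono) (auto simp: mult_left_le_one_le)
    finally have "\<bar>r 1 - r 0\<bar> \<le> L * norm h ^ 3"
      using t by (simp add: power2_eq_square power3_eq_cube mult_ac)
    moreover have "r 1 - r 0 = phi m A y - phi m A x - ?v x \<bullet> h - (real m - 1) / 2 * (h \<bullet> (tensor_mat m A x *v h))"
      by (simp add: r_def h_def scaleR_matrix_vector_assoc[symmetric])
    ultimately show ?thesis
      by (simp add: h_def)
  qed
  with L(1) that show ?thesis by blast
qed

lemma outer_mult_vec: "outer x y *v z = (y \<bullet> z) *\<^sub>R x"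
  by (simp add: vec_eq_iff outer_def matrix_vector_mult_def inner_vec_def sum_distrib_left mult_ac)

lemma F_jac_mult_vec:
  "F_jac m A x *v h = (real m - 1) *\<^sub>R (tensor_mat m A x *v h) - tensor_form m A x *\<^sub>R h
     - (real m * (tensor_vec m A x \<bullet> h)) *\<^sub>R x"
  by (simp add: F_jac_def matrix_vector_mult_diff_rdistrib scaleR_matrix_vector_assoc[symmetric]
      outer_mult_vec)

lemma inner_diff_sphere:
  assumes "norm x = 1" "norm y = 1"
  shows "x \<bullet> (y - x) = - (norm (y - x))\<^sup>2 / 2"
  using assms by (simp add: power2_norm_eq_inner inner_diff inner_commute norm_eq_1)

text \<open>
  On the sphere the constraint \<open>x \<bullet> (y - x) = - |y - x|^2 / 2\<close> turns the first-order term
  \<open>tensor_form m A x * (x \<bullet> (y - x))\<close> into a second-order one, so that \<open>F\<close> and \<open>F_jac\<close> replace gradient and Hessian.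
\<close>

lemma phi_sphere_expansion:
  fixes A :: "'n::finite list \<Rightarrow> real"
  assumes "symmetric_tensor m A" "m \<ge> 2"
  obtains K where "K > 0"
    "\<And>x y. \<lbrakk>norm x = 1; norm y = 1\<rbrakk> \<Longrightarrow>
       \<bar>phi m A y - phi m A x - F m A x \<bullet> (y - x) - (y - x) \<bullet> (F_jac m A x *v (y - x)) / 2\<bar>
         \<le> K * norm (y - x) ^ 3"
proof -
  obtain L where L: "L > 0" "\<And>x y. \<lbrakk>x \<in> cball 0 1; y \<in> cball 0 1\<rbrakk> \<Longrightarrow>
       \<bar>phi m A y - phi m A x - tensor_vec m A x \<bullet> (y - x)
         - (real m - 1) / 2 * ((y - x) \<bullet> (tensor_mat m A x *v (y - x)))\<bar> \<le> L * norm (y - x) ^ 3"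
    using phi_taylor_remainder[OF assms] by metis
  obtain B where B: "B > 0" "\<And>x. x \<in> cball 0 1 \<Longrightarrow> norm (tensor_vec m A x) \<le> B"
    using polynomial_function_bounded[OF polynomial_function_tensor_vec, of 1 m A] by metis
  have "\<bar>phi m A y - phi m A x - F m A x \<bullet> (y - x) - (y - x) \<bullet> (F_jac m A x *v (y - x)) / 2\<bar>
         \<le> (L + real m * B / 4) * norm (y - x) ^ 3" if xy: "norm x = 1" "norm y = 1" for x y
  proof -
    define h where "h = y - x"
    define R where "R = phi m A y - phi m A x - tensor_vec m A x \<bullet> h
      - (real m - 1) / 2 * (h \<bullet> (tensor_mat m A x *v h))"
    have R: "\<bar>R\<bar> \<le> L * norm h ^ 3"
      using L(2)[of x y] xy by (simp add: R_def h_def)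
    have xh: "x \<bullet> h = - (norm h)\<^sup>2 / 2"
      using inner_diff_sphere[OF xy] by (simp add: h_def)
    have "phi m A y - phi m A x - F m A x \<bullet> h - h \<bullet> (F_jac m A x *v h) / 2 =
      R + tensor_form m A x * (x \<bullet> h) + tensor_form m A x * (h \<bullet> h) / 2
        + real m * (tensor_vec m A x \<bullet> h) * (x \<bullet> h) / 2"
      by (simp add: R_def F_def F_jac_mult_vec inner_diff_left inner_diff_right inner_commute[of h x]
          diff_divide_distrib left_diff_distrib)
    \<comment> \<open>By \<open>xh\<close> the two \<open>tensor_form\<close> terms cancel. The
      rank-one part of \<open>F_jac\<close> leaves a product of
      \<open>tensor_vec m A x \<bullet> h\<close> with \<open>x \<bullet> h\<close>, which is of
      third order in \<open>h\<close>.\<close>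
    also have "\<dots> = R - real m * (tensor_vec m A x \<bullet> h) * (norm h)\<^sup>2 / 4"
      by (simp add: xh power2_norm_eq_inner)
    finally have eq: "phi m A y - phi m A x - F m A x \<bullet> h - h \<bullet> (F_jac m A x *v h) / 2 =
      R - real m * (tensor_vec m A x \<bullet> h) * (norm h)\<^sup>2 / 4" .
    have "\<bar>tensor_vec m A x \<bullet> h\<bar> \<le> B * norm h"
      using B xy by (intro order_trans[OF Cauchy_Schwarz_ineq2] mult_right_mono) auto
    then have "\<bar>real m * (tensor_vec m A x \<bullet> h) * (norm h)\<^sup>2 / 4\<bar> \<le> real m * (B * norm h) * (norm h)\<^sup>2 / 4"
      by (simp add: abs_mult mult_left_mono mult_right_mono)
    with R have "\<bar>R - real m * (tensor_vec m A x \<bullet> h) * (norm h)\<^sup>2 / 4\<bar>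
        \<le> L * norm h ^ 3 + real m * (B * norm h) * (norm h)\<^sup>2 / 4"
      by linarith
    then show ?thesis
      unfolding eq[unfolded h_def] by (simp add: h_def algebra_simps power2_eq_square power3_eq_cube)
  qed
  then show ?thesis
    using L(1) B(1) by (intro that[of "L + real m * B / 4"]) (auto intro!: add_pos_nonneg)
qed

text \<open>On the sphere \<open>F\<close> is the tangential part of the gradient. This makes it an
  admissible test vector in the Newton equations.\<close>

lemma F_orthogonal_sphere: "norm x = 1 \<Longrightarrow> x \<bullet> F m A x = 0"
  by (simp add: F_def tensor_form_def inner_diff_right norm_eq_1)

lemma norm_add_tangent:
  fixes x v :: "'a::real_inner"
  assumes "norm x = 1" "x \<bullet> v = 0"
  shows "norm (x + v) = sqrt (1 + (norm v)\<^sup>2)"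
  using assms by (simp add: norm_eq_sqrt_inner inner_add inner_commute)

lemma curve_scale: "curve x d a = curve x (a *\<^sub>R d) 1"
  by (simp add: curve_def)

text \<open>Normalizing \<open>x + v\<close> moves it by a vector \<open>e\<close> of second order.
  Replacing \<open>y - x\<close> by \<open>v\<close> in the expansion on the sphere then changes the
  linear and the quadratic term only in third order.\<close>

lemma phi_curve_expansion:
  fixes A :: "'n::finite list \<Rightarrow> real"
  assumes "symmetric_tensor m A" "m \<ge> 2"
  obtains K where "K > 0"
    "\<And>x v. \<lbrakk>norm x = 1; x \<bullet> v = 0; norm v \<le> 1\<rbrakk> \<Longrightarrow>
       \<bar>phi m A (curve x v 1) - phi m A x - F m A x \<bullet> v - v \<bullet> (F_jac m A x *v v) / 2\<bar>
         \<le> K * norm v ^ 3"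
proof -
  obtain K where K: "K > 0" "\<And>x y. \<lbrakk>norm x = 1; norm y = 1\<rbrakk> \<Longrightarrow>
       \<bar>phi m A y - phi m A x - F m A x \<bullet> (y - x) - (y - x) \<bullet> (F_jac m A x *v (y - x)) / 2\<bar>
         \<le> K * norm (y - x) ^ 3"
    using phi_sphere_expansion[OF assms] by metis
  obtain B where B: "B > 0" "\<And>x. x \<in> cball 0 1 \<Longrightarrow> norm (F m A x) \<le> B"
    using polynomial_function_bounded[OF polynomial_function_F, of 1 m A] by metis
  obtain C where C: "C > 0" "\<And>x. x \<in> cball 0 1 \<Longrightarrow> norm (F_jac m A x) \<le> C"
    using polynomial_function_bounded[OF polynomial_function_F_jac, of 1 m A] by metis
  \<comment> \<open>\<open>8 * K\<close> comes from \<open>norm h \<le> 2 * norm v\<close>,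
    \<open>B / 2\<close> from the linear term at \<open>e\<close>, and \<open>3 * C / 4\<close> is
    half of \<open>C + C / 2\<close> from the two cross terms of the quadratic form.\<close>
  have "\<bar>phi m A (curve x v 1) - phi m A x - F m A x \<bullet> v - v \<bullet> (F_jac m A x *v v) / 2\<bar>
         \<le> (8 * K + B / 2 + 3 * C / 4) * norm v ^ 3"
    if x: "norm x = 1" and v: "x \<bullet> v = 0" "norm v \<le> 1" for x v
  proof -
    define s where "s = norm (x + v)"
    define y where "y = curve x v 1"
    define e where "e = y - (x + v)"
    define h where "h = y - x"
    let ?M = "F_jac m A x"
    have s: "s = sqrt (1 + (norm v)\<^sup>2)"
      using norm_add_tangent[OF x v(1)] by (simp add: s_def)
    then have s1: "s \<ge> 1" by simp
    have "(norm v)\<^sup>2 = s\<^sup>2 - 1" using s by simp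
    moreover have "0 \<le> (s - 1)\<^sup>2" by simp
    ultimately have s2: "s - 1 \<le> (norm v)\<^sup>2 / 2"
      by (simp add: power2_eq_square algebra_simps)
    have y: "norm y = 1" "y = (1 / s) *\<^sub>R (x + v)"
      using s1 by (auto simp: y_def curve_def s_def inverse_eq_divide)
    have e: "e = (1 / s - 1) *\<^sub>R (x + v)"
      by (simp add: e_def y algebra_simps)
    have "norm e = \<bar>1 / s - 1\<bar> * s"
      unfolding e norm_scaleR by (simp add: s_def)
    also have "\<dots> = s - 1"
      using s1 by (simp add: abs_if field_simps)
    finally have ne: "norm e \<le> (norm v)\<^sup>2 / 2"
      using s2 by simp
    have hev: "h = v + e" by (simp add: h_def e_def)
    have "(norm v)\<^sup>2 \<le> norm v"
      using v by (simp add: power2_eq_square mult_left_le_one_le)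
    then have nh: "norm h \<le> 2 * norm v"
      using ne norm_triangle_ineq[of v e] norm_ge_zero[of v] unfolding hev by linarith
    \<comment> \<open>Cauchy-Schwarz with \<open>norm e\<close> would give only second order. As
      \<open>F\<close> is orthogonal to \<open>x\<close>, only the component of \<open>e\<close>
      along \<open>v\<close> counts, which gains a factor \<open>norm v\<close>.\<close>
    have "F m A x \<bullet> e = (1 / s - 1) * (F m A x \<bullet> v)"
      using F_orthogonal_sphere[OF x, of m A] by (simp add: e inner_add_right inner_commute[of _ x])
    moreover have "\<bar>1 / s - 1\<bar> \<le> s - 1"
      using s1 zero_le_power2[of "s - 1"] by (simp add: abs_if field_simps power2_eq_square)
    moreover have "\<bar>F m A x \<bullet> v\<bar> \<le> B * norm v"
      using B x by (intro order_trans[OF Cauchy_Schwarz_ineq2] mult_right_mono) auto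
    ultimately have Fe: "\<bar>F m A x \<bullet> e\<bar> \<le> (norm v)\<^sup>2 / 2 * (B * norm v)"
      using s2 by (auto simp only: abs_mult intro!: mult_mono)
    have M: "\<bar>u \<bullet> (?M *v w)\<bar> \<le> norm u * (C * norm w)" for u w
      using C x by (intro order_trans[OF Cauchy_Schwarz_ineq2] mult_left_mono
          order_trans[OF norm_matrix_vector_mult_le] mult_right_mono) auto
    have "\<bar>e \<bullet> (?M *v h)\<bar> \<le> (norm v)\<^sup>2 / 2 * (C * (2 * norm v))"
      using ne nh C(1) by (intro order_trans[OF M] mult_mono) auto
    moreover have "\<bar>v \<bullet> (?M *v e)\<bar> \<le> norm v * (C * ((norm v)\<^sup>2 / 2))"
      using ne C(1) by (intro order_trans[OF M] mult_mono) auto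
    moreover have "h \<bullet> (?M *v h) = v \<bullet> (?M *v v) + v \<bullet> (?M *v e) + e \<bullet> (?M *v h)"
      by (simp add: hev matrix_vector_right_distrib inner_add)
    moreover have "\<bar>phi m A y - phi m A x - F m A x \<bullet> h - h \<bullet> (?M *v h) / 2\<bar> \<le> K * (2 * norm v) ^ 3"
      unfolding h_def using K(1) nh[unfolded h_def]
      by (intro order_trans[OF K(2)[OF x y(1)]] mult_left_mono power_mono) auto
    moreover have "F m A x \<bullet> h = F m A x \<bullet> v + F m A x \<bullet> e"
      by (simp add: hev inner_add_right)
    ultimately have "\<bar>phi m A y - phi m A x - F m A x \<bullet> v - v \<bullet> (?M *v v) / 2\<bar>
        \<le> K * (2 * norm v) ^ 3 + (norm v)\<^sup>2 / 2 * (B * norm v)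
          + ((norm v)\<^sup>2 / 2 * (C * (2 * norm v)) + norm v * (C * ((norm v)\<^sup>2 / 2))) / 2"
      using Fe unfolding abs_le_iff by (auto simp: field_simps)
    also have "\<dots> = (8 * K + B / 2 + 3 * C / 4) * norm v ^ 3"
      by (simp add: power_mult_distrib power2_eq_square power3_eq_cube algebra_simps)
    finally show ?thesis by (simp add: y_def)
  qed
  then show ?thesis
    using K(1) B(1) C(1) by (intro that[of "8 * K + B / 2 + 3 * C / 4"]) auto
qed

subsection \<open>Second order sufficiency near the limit\<close>

lemma bounded_bilinear_matrix_vector_mult:
  "bounded_bilinear ((*v) :: real ^ 'n ^ 'm \<Rightarrow> real ^ 'n \<Rightarrow> real ^ 'm)"
  by (rule bounded_bilinear.intro)
     (auto simp: matrix_vector_mult_add_rdistrib matrix_vector_right_distrib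
       scaleR_matrix_vector_assoc matrix_vector_mult_scaleR norm_matrix_vector_mult_le
       intro!: exI[of _ 1])

text \<open>Coordinates of \<open>v\<close> in the columns of \<open>U\<close> turn the double sum
  of \<open>pos_def\<close> into the quadratic form of \<open>M\<close>. Distinctness allows the sum
  over \<open>set U\<close> to be indexed by positions.\<close>

lemma pos_def_compress_span:
  assumes U: "distinct U" and pd: "pos_def (length U) (compress U M)"
    and v: "v \<in> span (set U)" "v \<noteq> 0"
  shows "0 < v \<bullet> (M *v v)"
proof -
  obtain u where u: "v = (\<Sum>w\<in>set U. u w *\<^sub>R w)"
    using v(1) by (auto simp: span_finite)
  let ?y = "\<lambda>i. u (U ! i)"
  have vy: "v = (\<Sum>i<length U. ?y i *\<^sub>R (U ! i))"
    unfolding u using sum.reindex_bij_betw[OF bij_betw_nth[OF U refl refl], of "\<lambda>w. u w *\<^sub>R w"] by simp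
  have "\<exists>i<length U. ?y i \<noteq> 0"
  proof (rule ccontr)
    assume "\<not> ?thesis"
    then have "v = 0" unfolding vy by (intro sum.neutral) auto
    with v(2) show False by simp
  qed
  then have "0 < (\<Sum>i<length U. \<Sum>j<length U. ?y i * compress U M i j * ?y j)"
    using pd by (simp add: pos_def_def)
  also have "\<dots> = (\<Sum>i<length U. ?y i *\<^sub>R (U ! i)) \<bullet> (M *v (\<Sum>i<length U. ?y i *\<^sub>R (U ! i)))"
    by (subst sum.swap) (simp add: compress_def inner_sum_left inner_sum_right linear_sum[OF matrix_vector_mul_linear]
         matrix_vector_mult_scaleR mult_ac sum_distrib_left)
  finally show ?thesis by (simp only: vy[symmetric])
qed

text \<open>A compactness argument: the form exceeds some \<open>c\<close> on the unit tangent
  vectors at \<open>xbar\<close>. The base points carrying a unit tangent vector with value at most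
  \<open>c\<close> form a compact set that misses \<open>xbar\<close>, hence also a ball around it.
  Homogeneity removes the unit length.\<close>

lemma second_order_sufficient_near:
  fixes A :: "'n::finite list \<Rightarrow> real"
  assumes x: "norm xbar = 1" and U: "tangent_basis xbar U" and sos: "second_order_sufficient m A U xbar"
  obtains c \<delta> where "c > 0" "\<delta> > 0"
    "\<And>x v. \<lbrakk>norm x = 1; dist xbar x < \<delta>; x \<bullet> v = 0\<rbrakk> \<Longrightarrow> c * (norm v)\<^sup>2 \<le> v \<bullet> (F_jac m A x *v v)"
proof -
  define g where "g p = snd p \<bullet> (F_jac m A (fst p) *v snd p)" for p :: "(real ^ 'n) \<times> (real ^ 'n)"
  have cont: "continuous_on S g" for S
    unfolding g_def
    by (intro continuous_on_inner bounded_bilinear.continuous_on[OF bounded_bilinear_matrix_vector_mult]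
        continuous_on_compose2[OF polynomial_function_continuous_on[OF polynomial_function_F_jac, of UNIV]]
        continuous_intros subset_UNIV)
  have pos: "g (xbar, v) > 0" if "xbar \<bullet> v = 0" "v \<noteq> 0" for v
    unfolding g_def using that U sos
    by (auto simp: tangent_basis_def second_order_sufficient_def intro!: pos_def_compress_span[of U])
  define Z where "Z = (sphere 0 1 \<times> sphere 0 1) \<inter> {p :: (real ^ 'n) \<times> (real ^ 'n). fst p \<bullet> snd p = 0}"
  have Z: "compact Z"
    unfolding Z_def
    by (intro compact_Int_closed compact_Times compact_sphere closed_Collect_eq continuous_intros)
  have "\<exists>c>0. \<forall>v. xbar \<bullet> v = 0 \<longrightarrow> norm v = 1 \<longrightarrow> c < g (xbar, v)"
  proof (cases "Z \<inter> {xbar} \<times> UNIV = {}")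
    case False
    have "compact (Z \<inter> {xbar} \<times> UNIV)"
      by (intro compact_Int_closed Z closed_Times) auto
    then obtain p where p: "p \<in> Z \<inter> {xbar} \<times> UNIV" "\<And>q. q \<in> Z \<inter> {xbar} \<times> UNIV \<Longrightarrow> g p \<le> g q"
      using continuous_attains_inf[OF _ False cont] by blast
    then obtain v where "p = (xbar, v)" "xbar \<bullet> v = 0" "norm v = 1"
      by (cases p) (auto simp: Z_def)
    then have "0 < g p"
      using pos[of v] by fastforce
    have "g p / 2 < g (xbar, v)" if "xbar \<bullet> v = 0" "norm v = 1" for v
    proof -
      have "g p \<le> g (xbar, v)" using p that by (auto simp: Z_def)
      with \<open>0 < g p\<close> show ?thesis by simp
    qed
    with \<open>0 < g p\<close> show ?thesis by (intro exI[of _ "g p / 2"]) auto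
  next
    \<comment> \<open>There is no unit tangent vector, as happens in dimension one; any positive
      constant serves.\<close>
    case True
    have "(xbar, v) \<in> Z \<inter> {xbar} \<times> UNIV" if "xbar \<bullet> v = 0" "norm v = 1" for v
      using that x by (simp add: Z_def)
    with True show ?thesis
      by (intro exI[of _ 1]) auto
  qed
  then obtain c where c: "c > 0" "\<And>v. xbar \<bullet> v = 0 \<Longrightarrow> norm v = 1 \<Longrightarrow> c < g (xbar, v)"
    by metis
  define W where "W = Z \<inter> {p. g p \<le> c}"
  have "compact (fst ` W)"
    unfolding W_def
    by (intro compact_continuous_image continuous_intros compact_Int_closed Z
        closed_Collect_le cont)
  then have "open (- (fst ` W))"
    using compact_imp_closed by blast
  moreover have "xbar \<in> - (fst ` W)"
    using c(2) by (fastforce simp: W_def Z_def)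
  ultimately obtain \<delta> where \<delta>: "\<delta> > 0" "ball xbar \<delta> \<subseteq> - (fst ` W)"
    by (meson open_contains_ball)
  have "c * (norm v)\<^sup>2 \<le> v \<bullet> (F_jac m A x *v v)"
    if x: "norm x = 1" "dist xbar x < \<delta>" "x \<bullet> v = 0" for x v
  proof (cases "v = 0")
    case False
    let ?u = "v /\<^sub>R norm v"
    have "x \<notin> fst ` W" using \<delta>(2) x(2) by (auto simp: subset_iff)
    moreover have "(x, ?u) \<in> Z" using x False by (auto simp: Z_def)
    ultimately have "\<not> g (x, ?u) \<le> c"
      unfolding W_def by force
    then have "c < ?u \<bullet> (F_jac m A x *v ?u)" by (simp add: g_def)
    also have "\<dots> = (v \<bullet> (F_jac m A x *v v)) / (norm v)\<^sup>2"
      by (simp add: matrix_vector_mult_scaleR divide_inverse power2_eq_square mult_ac)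
    finally show ?thesis using False by (simp add: field_simps)
  qed simp
  then show ?thesis
    using that c(1) \<delta>(1) by blast
qed

subsection \<open>Newton directions\<close>

text \<open>Orthogonality to the columns extends to their span. The Newton system thus depends only
  on the tangent space, and any tangent vector may be used as a test vector.\<close>

lemma newton_direction_iff:
  assumes "tangent_basis x U"
  shows "newton_direction m A U x d \<longleftrightarrow>
    x \<bullet> d = 0 \<and> (\<forall>w. x \<bullet> w = 0 \<longrightarrow> w \<bullet> (F_jac m A x *v d) + w \<bullet> F m A x = 0)"
proof -
  let ?r = "F_jac m A x *v d + F m A x"
  have span: "span (set U) = {d. x \<bullet> d = 0}"
    using assms by (simp add: tangent_basis_def)
  have "(\<forall>j<length U. U ! j \<bullet> ?r = 0) \<longleftrightarrow> (\<forall>u\<in>set U. orthogonal ?r u)"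
    by (simp add: all_set_conv_all_nth orthogonal_def inner_commute[of ?r])
  also have "\<dots> \<longleftrightarrow> (\<forall>w. x \<bullet> w = 0 \<longrightarrow> w \<bullet> ?r = 0)"
    using orthogonal_to_span[of _ "set U" ?r] span_base[of _ "set U"] unfolding span
    by (auto simp: orthogonal_def inner_commute)
  finally show ?thesis
    unfolding newton_direction_def inner_add_right[symmetric] by blast
qed

text \<open>
  The Newton system is extended to the injective endomorphism
  \<open>d \<mapsto> P M P d + (x \<bullet> d) x\<close>, where \<open>P = I - x x^T\<close>.
\<close>

lemma tangent_system_solvable:
  fixes M :: "real ^ 'n ^ 'n"
  assumes x: "norm x = 1" and f: "x \<bullet> f = 0"
    and pos: "\<And>v. x \<bullet> v = 0 \<Longrightarrow> v \<noteq> 0 \<Longrightarrow> 0 < v \<bullet> (M *v v)"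
  shows "\<exists>d. x \<bullet> d = 0 \<and> (\<forall>w. x \<bullet> w = 0 \<longrightarrow> w \<bullet> (M *v d) + w \<bullet> f = 0)"
proof -
  define P where "P v = v - (x \<bullet> v) *\<^sub>R x" for v
  define T where "T v = P (M *v P v) + (x \<bullet> v) *\<^sub>R x" for v
  have xx: "x \<bullet> x = 1" using x by (simp add: norm_eq_1)
  have xP: "x \<bullet> P v = 0" for v by (simp add: P_def inner_diff_right xx)
  have xT: "x \<bullet> T v = x \<bullet> v" for v by (simp add: T_def inner_add_right xP xx)
  have T: "w \<bullet> T v = w \<bullet> (M *v v)" if "x \<bullet> v = 0" "x \<bullet> w = 0" for v w
    using that by (simp add: T_def P_def inner_diff_right inner_commute)
  have P: "linear P"
    by (rule linearI) (simp_all add: P_def algebra_simps inner_add_right)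
  have "linear T"
    by (rule linearI)
       (simp_all add: T_def linear_add[OF P] linear_scale[OF P] matrix_vector_right_distrib
         matrix_vector_mult_scaleR inner_add_right algebra_simps)
  \<comment> \<open>The component of \<open>T v\<close> along \<open>x\<close> forces
    \<open>v\<close> to be tangent; then
    \<open>v \<bullet> (M *v v) = v \<bullet> T v = 0\<close>.\<close>
  moreover have "v = 0" if "T v = 0" for v
    using pos[of v] T[of v v] xT[of v] that by auto
  ultimately have "surj T"
    by (simp add: linear_injective_0 linear_injective_imp_surjective)
  then obtain d where d: "T d = - f" by (metis surjD)
  have "x \<bullet> d = 0" using xT[of d] d f by simp
  with T[of d] d show ?thesis by (intro exI[of _ d]) (metis add.commute ab_group_add_class.ab_left_minus inner_minus_right)
qed

lemma newton_direction_exists: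
  assumes "tangent_basis x U" "norm x = 1"
    and "\<And>v. x \<bullet> v = 0 \<Longrightarrow> v \<noteq> 0 \<Longrightarrow> 0 < v \<bullet> (F_jac m A x *v v)"
  shows "\<exists>d. newton_direction m A U x d"
  unfolding newton_direction_iff[OF assms(1)]
  using assms by (intro tangent_system_solvable F_orthogonal_sphere)

text \<open>
  Along a Newton direction the quadratic term of the expansion of \<open>phi\<close> is \<open>- F \<bullet> d / 2\<close>; this is
  where \<open>\<sigma> < 1 / 2\<close> enters.
\<close>

lemma armijo_newton:
  assumes x: "norm x = 1" and d: "x \<bullet> d = 0"
    and newton: "d \<bullet> (F_jac m A x *v d) = - (F m A x \<bullet> d)"
    and coercive: "c * (norm d)\<^sup>2 \<le> - (F m A x \<bullet> d)" "0 < c" and \<sigma>: "\<sigma> < 1 / 2"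
    and K: "\<And>v. \<lbrakk>x \<bullet> v = 0; norm v \<le> 1\<rbrakk> \<Longrightarrow>
       \<bar>phi m A (curve x v 1) - phi m A x - F m A x \<bullet> v - v \<bullet> (F_jac m A x *v v) / 2\<bar> \<le> K * norm v ^ 3"
    and a: "0 < a" "a \<le> 1" "a * norm d \<le> 1" "K * (a * norm d) \<le> c * (1 / 2 - \<sigma>)"
  shows "armijo m A \<sigma> x d a"
proof -
  define q where "q = - (F m A x \<bullet> d)"
  have q: "c * (norm d)\<^sup>2 \<le> q"
    using coercive by (simp add: q_def)
  have "0 \<le> c * (norm d)\<^sup>2"
    using coercive(2) by simp
  then have q0: "0 \<le> q"
    using q by linarith
  have "x \<bullet> (x + a *\<^sub>R d) = 1"
    using x d by (simp add: inner_add_right norm_eq_1)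
  then have nz: "x + a *\<^sub>R d \<noteq> 0" by auto
  have "\<bar>phi m A (curve x d a) - phi m A x - F m A x \<bullet> (a *\<^sub>R d) - (a *\<^sub>R d) \<bullet> (F_jac m A x *v (a *\<^sub>R d)) / 2\<bar>
      \<le> K * norm (a *\<^sub>R d) ^ 3"
    using K[of "a *\<^sub>R d"] d a by (simp add: curve_scale[of x d a])
  moreover have "(a *\<^sub>R d) \<bullet> (F_jac m A x *v (a *\<^sub>R d)) = a\<^sup>2 * q"
    by (simp add: matrix_vector_mult_scaleR newton q_def power2_eq_square)
  moreover have "F m A x \<bullet> (a *\<^sub>R d) = - (a * q)"
    by (simp add: q_def)
  ultimately have phi: "phi m A (curve x d a) \<le> phi m A x - a * q + a\<^sup>2 * q / 2 + K * norm (a *\<^sub>R d) ^ 3"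
    by linarith
  have a2: "a\<^sup>2 \<le> a" using a by (simp add: power2_eq_square mult_left_le_one_le)
  \<comment> \<open>One factor \<open>a * norm d\<close> of the cubic error is small by assumption;
    the other two are absorbed by \<open>c * (norm d)^2 \<le> q\<close>. The error then fits into
    the gap \<open>(1 / 2 - \<sigma>) * a * q\<close>.\<close>
  have "K * norm (a *\<^sub>R d) ^ 3 = a\<^sup>2 * ((norm d)\<^sup>2 * (K * (a * norm d)))"
    using a by (simp add: power2_eq_square power3_eq_cube)
  also have "\<dots> \<le> a\<^sup>2 * ((norm d)\<^sup>2 * (c * (1 / 2 - \<sigma>)))"
    using a by (intro mult_left_mono) auto
  also have "\<dots> = a\<^sup>2 * ((c * (norm d)\<^sup>2) * (1 / 2 - \<sigma>))"
    by (simp add: mult_ac)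
  also have "\<dots> \<le> a * (q * (1 / 2 - \<sigma>))"
    using a2 q q0 \<sigma> a(1) coercive(2) by (intro mult_mono mult_nonneg_nonneg) auto
  finally have "K * norm (a *\<^sub>R d) ^ 3 \<le> a * q / 2 - \<sigma> * a * q"
    by (simp add: algebra_simps)
  moreover have "a\<^sup>2 * q / 2 \<le> a * q / 2"
    using a2 q0 by (simp add: mult_right_mono)
  ultimately have "phi m A (curve x d a) \<le> phi m A x - \<sigma> * a * q"
    using phi by linarith
  with nz show ?thesis by (simp add: armijo_def q_def)
qed

text \<open>The error \<open>z - (x + d)\<close>, made tangent by a second-order correction, is
  inserted as test vector into the Newton equation. Coercivity then bounds it by the linearization
  error of \<open>F\<close> and that correction.\<close>

lemma newton_step_quadratic:
  assumes x: "norm x = 1" "norm z = 1" and Fz: "F m A z = 0"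
    and d: "x \<bullet> d = 0" "\<And>w. x \<bullet> w = 0 \<Longrightarrow> w \<bullet> (F_jac m A x *v d) + w \<bullet> F m A x = 0"
    and coercive: "\<And>v. x \<bullet> v = 0 \<Longrightarrow> c * (norm v)\<^sup>2 \<le> v \<bullet> (F_jac m A x *v v)" "0 < c"
    and L: "norm (F m A z - F m A x - F_jac m A x *v (z - x)) \<le> L * (norm (z - x))\<^sup>2"
    and C: "norm (F_jac m A x) \<le> C"
  shows "norm (curve x d 1 - z) \<le> (2 * (L + C / 2) / c + 1) * (norm (x - z))\<^sup>2"
proof -
  let ?M = "F_jac m A x"
  define e where "e = z - x"
  define t where "t = (norm e)\<^sup>2 / 2"
  \<comment> \<open>Since \<open>x \<bullet> e = - t\<close>, adding \<open>t *\<^sub>R x\<close>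
    makes \<open>e\<close> tangent at \<open>x\<close>.\<close>
  define w where "w = e + t *\<^sub>R x - d"
  define r where "r = F m A z - F m A x - ?M *v e"
  have xe: "x \<bullet> e = - t" using inner_diff_sphere[OF x] by (simp add: e_def t_def)
  have xw: "x \<bullet> w = 0"
    using x d(1) by (simp add: w_def inner_diff_right inner_add_right xe norm_eq_1)
  have t: "0 \<le> t" by (simp add: t_def)
  have Fx: "F m A x = - (?M *v e) - r" by (simp add: r_def Fz)
  have "w \<bullet> (?M *v w) = w \<bullet> (?M *v e) + t * (w \<bullet> (?M *v x)) - w \<bullet> (?M *v d)"
    by (subst (2) w_def) (simp add: matrix_vector_mult_diff_distrib matrix_vector_right_distrib
        matrix_vector_mult_scaleR inner_diff_right inner_add_right)
  also have "\<dots> = t * (w \<bullet> (?M *v x)) - w \<bullet> r"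
    using d(2)[OF xw] by (simp add: Fx inner_diff_right)
  also have "\<dots> \<le> t * (norm w * C) + norm w * (L * (norm e)\<^sup>2)"
  proof -
    have "w \<bullet> (?M *v x) \<le> norm w * C"
      using norm_matrix_vector_mult_le[of ?M x] x C
      by (intro order_trans[OF norm_cauchy_schwarz] mult_left_mono) auto
    moreover have "- (w \<bullet> r) \<le> norm w * (L * (norm e)\<^sup>2)"
      using norm_cauchy_schwarz[of "- w" r] L mult_left_mono[of "norm r" "L * (norm e)\<^sup>2" "norm w"]
      by (simp add: r_def e_def)
    ultimately show ?thesis
      using mult_left_mono[OF _ t] by fastforce
  qed
  also have "\<dots> = norm w * ((L + C / 2) * (norm e)\<^sup>2)"
    by (simp add: t_def algebra_simps)
  finally have "c * (norm w)\<^sup>2 \<le> norm w * ((L + C / 2) * (norm e)\<^sup>2)"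
    using coercive(1)[OF xw] by simp
  then have "norm w * (c * norm w) \<le> norm w * ((L + C / 2) * (norm e)\<^sup>2)"
    by (simp add: power2_eq_square mult_ac)
  \<comment> \<open>This settles the case \<open>w = 0\<close>, in which \<open>norm w\<close>
    cannot be cancelled.\<close>
  moreover have "0 \<le> (L + C / 2) * (norm e)\<^sup>2"
  proof -
    have "0 \<le> L * (norm e)\<^sup>2" using L norm_ge_zero order_trans unfolding e_def by blast
    moreover have "0 \<le> C" using C norm_ge_zero order_trans by blast
    ultimately show ?thesis by (simp add: distrib_right)
  qed
  ultimately have "c * norm w \<le> (L + C / 2) * (norm e)\<^sup>2"
    by (cases "w = 0") auto
  define W where "W = (L + C / 2) / c * (norm e)\<^sup>2"
  have nw: "norm w \<le> W"
    using \<open>c * norm w \<le> _\<close> coercive(2) by (simp add: W_def field_simps)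
  define y where "y = x + d"
  have "y - z = t *\<^sub>R x - w" by (simp add: y_def w_def e_def)
  then have "norm (y - z) \<le> t + W"
    using norm_triangle_ineq4[of "t *\<^sub>R x" w] x t nw by simp
  \<comment> \<open>Because \<open>z\<close> has norm 1, projecting \<open>y\<close> to the sphere
    moves it by no more than its distance to \<open>z\<close>.\<close>
  moreover have "norm (curve x d 1 - z) \<le> 2 * norm (y - z)"
  proof -
    have "x \<bullet> y = 1" using x d by (simp add: y_def inner_add_right norm_eq_1)
    then have "y \<noteq> 0" by auto
    then have "y /\<^sub>R norm y - y = (inverse (norm y) * (1 - norm y)) *\<^sub>R y"
      by (simp add: algebra_simps)
    then have "norm (y /\<^sub>R norm y - y) = \<bar>norm y - norm z\<bar>"
      using \<open>y \<noteq> 0\<close> x by (simp add: abs_mult abs_minus_commute)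
    also have "\<dots> \<le> norm (y - z)" by (rule norm_triangle_ineq3)
    finally show ?thesis
      using norm_triangle_ineq[of "y /\<^sub>R norm y - y" "y - z"] by (simp add: curve_def y_def)
  qed
  ultimately have "norm (curve x d 1 - z) \<le> 2 * (t + W)"
    using mult_left_mono[of "norm (y - z)" "t + W" 2] order_trans by auto
  also have "\<dots> = (2 * (L + C / 2) / c + 1) * (norm (x - z))\<^sup>2"
    by (simp add: t_def W_def e_def norm_minus_commute algebra_simps)
  finally show ?thesis .
qed

section \<open>Consequences of the Armijo condition for short steps\<close>

lemma newton_curve_descent:
  assumes "0 < \<eta>" "0 < \<sigma>" "F m A x \<bullet> d < 0"
    and armijo: "\<And>a. \<lbrakk>0 < a; a \<le> 1; a * norm d \<le> \<eta>\<rbrakk> \<Longrightarrow> armijo m A \<sigma> x d a"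
  shows "curve_descent (phi m A) x d"
proof -
  have "d \<noteq> 0" using assms(3) by auto
  let ?b = "min 1 (\<eta> / norm d)"
  have "0 < ?b" using assms \<open>d \<noteq> 0\<close> by simp
  have "phi m A (curve x d a) < phi m A x" if "a \<in> {0<..<?b}" for a
  proof -
    have "armijo m A \<sigma> x d a"
      using that \<open>d \<noteq> 0\<close> by (intro armijo) (auto simp: field_simps)
    moreover have "\<sigma> * a * (F m A x \<bullet> d) < 0"
      using that assms by (simp add: mult_pos_neg)
    ultimately show ?thesis by (simp add: armijo_def)
  qed
  then show ?thesis
    unfolding curve_descent_def
    by (rule eventually_mono[OF eventually_at_right_real[OF \<open>0 < ?b\<close>]])
qed

text \<open>If \<open>\<alpha>\<close> is not 1, the trial step \<open>\<alpha> / \<rho>\<close> was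
  rejected, so its length \<open>\<alpha> * norm d / \<rho>\<close> must exceed
  \<open>\<eta>\<close>.\<close>

lemma backtracking_step_cases:
  assumes bt: "backtracking_step m A \<sigma> \<rho> x d \<alpha>" and \<rho>: "0 < \<rho>" "\<rho> < 1"
    and armijo: "\<And>a. \<lbrakk>0 < a; a \<le> 1; a * norm d \<le> \<eta>\<rbrakk> \<Longrightarrow> armijo m A \<sigma> x d a"
  shows "\<alpha> = 1 \<or> \<rho> * \<eta> < \<alpha> * norm d"
proof -
  obtain i where i: "\<alpha> = \<rho> ^ i"
    using bt by (auto simp: backtracking_step_def)
  show ?thesis
  proof (cases i)
    case (Suc j)
    have "\<rho> ^ i < \<rho> ^ j" using \<rho> Suc by (simp add: power_Suc_less)
    then have "\<not> armijo m A \<sigma> x d (\<rho> ^ j)"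
      using bt i by (auto simp: backtracking_step_def not_le)
    then have "\<eta> < \<rho> ^ j * norm d"
      using armijo[of "\<rho> ^ j"] \<rho> by (force simp: power_le_one)
    then show ?thesis
      using \<rho> i Suc by (simp add: mult.assoc)
  qed (use i in simp)
qed

section \<open>Iterates of a run and their convergence\<close>

text \<open>This is the cosine of the angle between consecutive iterates; it allows the length of a
  tangent step to be recovered from the iterates alone.\<close>

lemma inner_curve_tangent:
  assumes "norm x = 1" "x \<bullet> d = 0"
  shows "x \<bullet> curve x d a = 1 / sqrt (1 + (norm (a *\<^sub>R d))\<^sup>2)"
  using assms norm_add_tangent[of x "a *\<^sub>R d"]
  by (simp add: curve_def inner_add_right norm_eq_1 inverse_eq_divide)

text \<open>An accepted step satisfies the first conjunct of \<open>armijo\<close>, so the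
  normalization never divides by zero, even for fallback directions.\<close>

lemma global_newton_run_norm:
  assumes "global_newton_run m A U \<sigma> \<mu> \<rho> x d \<alpha>"
  shows "norm (x k) = 1"
proof (cases k)
  case (Suc j)
  have "x j + \<alpha> j *\<^sub>R d j \<noteq> 0" "x k = curve (x j) (d j) (\<alpha> j)"
    using assms Suc by (auto simp: global_newton_run_def backtracking_step_def armijo_def)
  then show ?thesis by (simp add: curve_def)
qed (use assms in \<open>simp add: global_newton_run_def\<close>)

theorem theorem2p8:
  fixes A :: "'n::finite list \<Rightarrow> real" and m :: nat
    and U :: "real ^ 'n \<Rightarrow> (real ^ 'n) list"
    and \<sigma> \<mu> \<rho> :: real
    and x d :: "nat \<Rightarrow> real ^ 'n" and \<alpha> :: "nat \<Rightarrow> real" and xbar :: "real ^ 'n"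
  assumes "m \<ge> 2" and "symmetric_tensor m A"
    and "\<And>y. y \<in> sphere 0 1 \<Longrightarrow> tangent_basis y (U y)"
    and "0 < \<sigma>" and "\<sigma> < 1 / 2" and "0 < \<mu>" and "0 < \<rho>" and "\<rho> < 1"
    and "global_newton_run m A U \<sigma> \<mu> \<rho> x d \<alpha>"
    and "x \<longlonglongrightarrow> xbar" and "xbar \<in> sphere 0 1"
    and "second_order_sufficient m A (U xbar) xbar"
  shows "(\<lambda>k. norm (x (Suc k) - xbar)) \<in> O(\<lambda>k. (norm (x k - xbar))\<^sup>2) \<and>
         (\<forall>\<^sub>F k in sequentially. \<alpha> k = 1)"
proof -
  have nxbar: "norm xbar = 1" using assms(11) by simp
  have nx: "norm (x k) = 1" for k
    by (rule global_newton_run_norm[OF assms(9)])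
  have basis: "tangent_basis y (U y)" if "norm y = 1" for y
    using assms(3) that by simp
  have Fnz: "F m A (x k) \<noteq> 0" and step: "step_direction m A (U (x k)) \<mu> (x k) (d k)"
    and bt: "backtracking_step m A \<sigma> \<rho> (x k) (d k) (\<alpha> k)"
    and next_x: "x (Suc k) = curve (x k) (d k) (\<alpha> k)" for k
    using assms(9) by (auto simp: global_newton_run_def)
  obtain c \<delta> where c: "c > 0" and \<delta>: "\<delta> > 0" and coercive:
    "\<And>y v. \<lbrakk>norm y = 1; dist xbar y < \<delta>; y \<bullet> v = 0\<rbrakk> \<Longrightarrow> c * (norm v)\<^sup>2 \<le> v \<bullet> (F_jac m A y *v v)"
    using second_order_sufficient_near[OF nxbar basis[OF nxbar] assms(12)] by metis
  obtain K where K: "K > 0" "\<And>y v. \<lbrakk>norm y = 1; y \<bullet> v = 0; norm v \<le> 1\<rbrakk> \<Longrightarrow>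
       \<bar>phi m A (curve y v 1) - phi m A y - F m A y \<bullet> v - v \<bullet> (F_jac m A y *v v) / 2\<bar> \<le> K * norm v ^ 3"
    using phi_curve_expansion[OF assms(2,1)] by metis
  obtain L where L: "L > 0" "\<And>y z. \<lbrakk>y \<in> cball 0 1; z \<in> cball 0 1\<rbrakk> \<Longrightarrow>
       norm (F m A z - F m A y - F_jac m A y *v (z - y)) \<le> L * (norm (z - y))\<^sup>2"
    using taylor_remainder_polynomial_jacobian[OF F_has_derivative[OF assms(2,1)] polynomial_function_F_jac]
    by metis
  obtain C where C: "C > 0" "\<And>y. y \<in> cball 0 1 \<Longrightarrow> norm (F_jac m A y) \<le> C"
    using polynomial_function_bounded[OF polynomial_function_F_jac, of 1 m A] by metis
  \<comment> \<open>The bound 1 keeps steps in the range of the expansion \<open>K\<close>; the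
    other bound lets the cubic error be absorbed in \<open>armijo_newton\<close>.\<close>
  define \<eta> where "\<eta> = min 1 (c * (1 / 2 - \<sigma>) / K)"
  have \<eta>: "0 < \<eta>" "\<eta> \<le> 1" "K * \<eta> \<le> c * (1 / 2 - \<sigma>)"
    using c K(1) assms(5) by (auto simp: \<eta>_def min_def field_simps)

  let ?near = "\<lambda>k. dist xbar (x k) < \<delta>"
  have near: "\<forall>\<^sub>F k in sequentially. ?near k"
    using tendstoD[OF assms(10) \<delta>] by (simp add: dist_commute)

  have newton: "x k \<bullet> e = 0"
      "\<And>w. x k \<bullet> w = 0 \<Longrightarrow> w \<bullet> (F_jac m A (x k) *v e) + w \<bullet> F m A (x k) = 0"
    if "newton_direction m A (U (x k)) (x k) e" for k e
    using that newton_direction_iff[OF basis[OF nx]] by auto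
  have descent: "c * (norm e)\<^sup>2 \<le> - (F m A (x k) \<bullet> e)"
    "\<And>a. \<lbrakk>0 < a; a \<le> 1; a * norm e \<le> \<eta>\<rbrakk> \<Longrightarrow> armijo m A \<sigma> (x k) e a"
    if k: "?near k" and e: "newton_direction m A (U (x k)) (x k) e" for k e
  proof -
    note te = newton(1)[OF e]
    have q: "e \<bullet> (F_jac m A (x k) *v e) = - (F m A (x k) \<bullet> e)"
      using newton(2)[OF e te] by (simp add: inner_commute)
    then show q2: "c * (norm e)\<^sup>2 \<le> - (F m A (x k) \<bullet> e)"
      using coercive[OF nx k te] by simp
    show "armijo m A \<sigma> (x k) e a" if a: "0 < a" "a \<le> 1" "a * norm e \<le> \<eta>" for a
    proof (rule armijo_newton[OF nx te q q2 c assms(5) K(2)[OF nx]])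
      show "K * (a * norm e) \<le> c * (1 / 2 - \<sigma>)"
        using \<eta>(3) a(3) K(1) by (meson less_imp_le mult_left_mono order_trans)
    qed (use a \<eta> in auto)
  qed
  \<comment> \<open>Proved for every Newton direction \<open>e\<close>, since the fallback is open
    as soon as one of them fails to be a curve descent direction.\<close>
  have newton_descent: "curve_descent (phi m A) (x k) e"
    if k: "?near k" and e: "newton_direction m A (U (x k)) (x k) e" for k e
  proof (rule newton_curve_descent[OF \<eta>(1) assms(4) _ descent(2)[OF k e]])
    \<comment> \<open>For \<open>e = 0\<close>, testing the Newton equation with \<open>F\<close>
      itself would give \<open>F m A (x k) = 0\<close>.\<close>
    have "e \<noteq> 0"
      using newton(2)[OF e F_orthogonal_sphere[OF nx, where m = m and A = A]] Fnz by auto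
    then have "0 < c * (norm e)\<^sup>2"
      using c by simp
    then show "F m A (x k) \<bullet> e < 0"
      using descent(1)[OF k e] by linarith
  qed
  have newton_d: "newton_direction m A (U (x k)) (x k) (d k)" if k: "?near k" for k
  proof -
    have "0 < v \<bullet> (F_jac m A (x k) *v v)" if "x k \<bullet> v = 0" "v \<noteq> 0" for v
    proof -
      have "0 < c * (norm v)\<^sup>2" using c that by simp
      then show ?thesis using coercive[OF nx k that(1)] by linarith
    qed
    then have "\<exists>e. newton_direction m A (U (x k)) (x k) e"
      by (intro newton_direction_exists basis nx)
    then show ?thesis
      using step[of k] newton_descent[OF k] by (auto simp: step_direction_def)
  qed

  define u where "u k = norm (\<alpha> k *\<^sub>R d k)" for k
  have \<alpha>pos: "0 < \<alpha> k" for k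
    using bt[of k] assms(7) by (auto simp: backtracking_step_def)
  have u_lim: "u \<longlonglongrightarrow> 0"
  proof -
    have "(\<lambda>k. x k \<bullet> x (Suc k)) \<longlonglongrightarrow> xbar \<bullet> xbar"
      by (intro tendsto_inner assms(10) LIMSEQ_Suc)
    \<comment> \<open>This solves \<open>x k \<bullet> x (Suc k) = 1 / sqrt (1 + (u k)^2)\<close>
      for \<open>u k\<close>; the inner products tend to 1.\<close>
    then have "(\<lambda>k. sqrt (1 / (x k \<bullet> x (Suc k))\<^sup>2 - 1)) \<longlonglongrightarrow> sqrt (1 / 1\<^sup>2 - 1)"
      using nxbar by (intro tendsto_intros) (auto simp: norm_eq_1)
    moreover have "\<forall>\<^sub>F k in sequentially. sqrt (1 / (x k \<bullet> x (Suc k))\<^sup>2 - 1) = u k"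
      using near
    proof eventually_elim
      case (elim k)
      have "x k \<bullet> x (Suc k) = 1 / sqrt (1 + (u k)\<^sup>2)"
        unfolding next_x u_def using inner_curve_tangent[OF nx newton(1)[OF newton_d[OF elim]]] .
      then show ?case
        by (simp add: power_divide u_def)
    qed
    ultimately show ?thesis
      using Lim_transform_eventually by force
  qed
  \<comment> \<open>Once \<open>u k < \<rho> * \<eta>\<close>, only the alternative of a full step
    remains in \<open>backtracking_step_cases\<close>.\<close>
  have full: "\<forall>\<^sub>F k in sequentially. \<alpha> k = 1"
    using near order_tendstoD(2)[OF u_lim mult_pos_pos[OF assms(7) \<eta>(1)]]
  proof eventually_elim
    case (elim k)
    then show ?case
      using backtracking_step_cases[where \<eta> = \<eta>, OF bt assms(7,8) descent(2)[OF elim(1) newton_d[OF elim(1)]]]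
        \<alpha>pos[of k] by (auto simp: u_def)
  qed

  have "F m A xbar = 0"
  proof -
    have "isCont (F m A) xbar"
      using polynomial_function_continuous_on[OF polynomial_function_F[of m A], of UNIV]
      by (simp add: continuous_on_eq_continuous_at)
    then have "(\<lambda>k. F m A (x k)) \<longlonglongrightarrow> F m A xbar"
      using assms(10) isCont_tendsto_compose by blast
    moreover have "(\<lambda>k. F m A (x k)) \<longlonglongrightarrow> 0"
    proof (rule Lim_null_comparison)
      show "(\<lambda>k. C * u k) \<longlonglongrightarrow> 0"
        using tendsto_mult_right_zero[OF u_lim] .
      show "\<forall>\<^sub>F k in sequentially. norm (F m A (x k)) \<le> C * u k"
        using near full
      proof eventually_elim
        case (elim k)
        let ?F = "F m A (x k)"
        \<comment> \<open>Testing the Newton equation with \<open>F\<close> bounds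
          \<open>norm ?F\<close> by \<open>C * norm (d k)\<close>, and \<open>u k\<close> is
          \<open>norm (d k)\<close> for a full step.\<close>
        have "?F \<bullet> ?F = ?F \<bullet> - (F_jac m A (x k) *v d k)"
          using newton(2)[OF newton_d[OF elim(1)] F_orthogonal_sphere[OF nx, where m = m and A = A]] by simp
        also have "\<dots> \<le> norm ?F * norm (F_jac m A (x k) *v d k)"
          using norm_cauchy_schwarz[of ?F "- (F_jac m A (x k) *v d k)"] by simp
        finally have "norm ?F * norm ?F \<le> norm ?F * norm (F_jac m A (x k) *v d k)"
          by (simp add: power2_norm_eq_inner[symmetric] power2_eq_square)
        then have "norm ?F \<le> norm (F_jac m A (x k) *v d k)"
          using Fnz by simp
        also have "\<dots> \<le> norm (F_jac m A (x k)) * norm (d k)"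
          by (rule norm_matrix_vector_mult_le)
        also have "\<dots> \<le> C * u k"
          using C nx elim(2) by (auto simp: u_def intro!: mult_right_mono)
        finally show ?case .
      qed
    qed
    ultimately show ?thesis
      by (rule LIMSEQ_unique)
  qed
  have "\<forall>\<^sub>F k in sequentially.
      norm (x (Suc k) - xbar) \<le> (2 * (L + C / 2) / c + 1) * (norm (x k - xbar))\<^sup>2"
    using near full
  proof eventually_elim
    case (elim k)
    note d = newton_d[OF elim(1)]
    have "norm (curve (x k) (d k) 1 - xbar) \<le> (2 * (L + C / 2) / c + 1) * (norm (x k - xbar))\<^sup>2"
      by (rule newton_step_quadratic[OF nx nxbar \<open>F m A xbar = 0\<close> newton(1)[OF d] newton(2)[OF d]
            coercive[OF nx elim(1)] c]) (use L C nx nxbar in auto)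
    then show ?case
      by (simp add: next_x elim(2))
  qed
  then have "(\<lambda>k. norm (x (Suc k) - xbar)) \<in> O(\<lambda>k. (norm (x k - xbar))\<^sup>2)"
    by (intro bigoI) simp
  with full show ?thesis by blast
qed

end
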